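(* Let $t\ge 0$ be an integer. The graph $S(t)$ is matching unique except when $t\in\{2,3,4\}$, in which cases it is not matching unique; and the graph $S'(t)$ is matching unique except when $t\in\{2,3\}$, in which cases it is not matching unique.
   Context: All graphs are finite, simple and undirected. For a graph $G$ of order $n$ (number of vertices), $m(G,k)$ is the number of $k$-matchings (sets of $k$ pairwise nonincident edges), $m(G,0)=1$, and the matching polynomial of $G$ is $\mu(G,x)=\sum_{k\ge 0}(-1)^k m(G,k)x^{n-2k}$. Two nonisomorphic graphs with the same matching polynomial are comatching. A graph $G$ is matching unique if it has no comatching graph, i.e. every graph $H$ (connected or not) with $\mu(H,x)=\mu(G,x)$ is isomorphic to $G$. For an integer $t\ge 0$, $S(t)$ (also written $K(1,t;1)$) is the graph obtained from the disjoint union of $K_2$ and $t$ isolated vertices by adding a new vertex $u$ and joining $u$ to all $t$ isolated vertices and to exactly one vertex of $K_2$. $S'(t)$ (also written $K'(1,t;1)$) is the graph obtained in the same way except that $u$ is joined to all $t$ isolated vertices and to both vertices of $K_2$ (so $S'(t)$ is a triangle with $t$ pendant vertices attached to one of its vertices). *)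

theory Defs
  imports "HOL-Computational_Algebra.Polynomial"
begin

text \<open>A graph is a pair of a vertex set and a set of edges, an edge being a two-element set
  of vertices.\<close>

type_synonym 'a graph = "'a set \<times> 'a set set"

abbreviation verts :: "'a graph \<Rightarrow> 'a set" where
  "verts G \<equiv> fst G"

abbreviation edges :: "'a graph \<Rightarrow> 'a set set" where
  "edges G \<equiv> snd G"

definition simple_graph :: "'a graph \<Rightarrow> bool" where
  "simple_graph G \<longleftrightarrow> finite (verts G) \<and> (\<forall>e\<in>edges G. e \<subseteq> verts G \<and> card e = 2)"

definition graph_iso :: "'a graph \<Rightarrow> 'b graph \<Rightarrow> bool" where
  "graph_iso G H \<longleftrightarrow>
     (\<exists>f. bij_betw f (verts G) (verts H) \<and>
          (\<forall>u\<in>verts G. \<forall>v\<in>verts G. {u, v} \<in> edges G \<longleftrightarrow> {f u, f v} \<in> edges H))"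

definition graph_order :: "'a graph \<Rightarrow> nat" where
  "graph_order G = card (verts G)"

definition k_matchings :: "'a graph \<Rightarrow> nat \<Rightarrow> 'a set set set" where
  "k_matchings G k = {M. M \<subseteq> edges G \<and> card M = k \<and> finite M \<and> pairwise disjnt M}"

definition num_matchings :: "'a graph \<Rightarrow> nat \<Rightarrow> nat" where
  "num_matchings G k = card (k_matchings G k)"

text \<open>A \<open>k\<close>-matching covers \<open>2 * k\<close> vertices, so the terms with \<open>2 * k > graph_order G\<close> vanish; cutting
  the sum off there keeps the exponent clear of truncated subtraction.\<close>

definition matching_poly :: "'a graph \<Rightarrow> int poly" where
  "matching_poly G =
     (\<Sum>k\<le>graph_order G div 2. monom ((-1) ^ k * int (num_matchings G k)) (graph_order G - 2 * k))"

definition comatching :: "'a graph \<Rightarrow> 'b graph \<Rightarrow> bool" where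
  "comatching G H \<longleftrightarrow> \<not> graph_iso G H \<and> matching_poly G = matching_poly H"

text \<open>HOL cannot quantify over all types inside a definition. Letting \<open>H\<close> range over the graphs
  with vertices in \<^typ>\<open>nat\<close> loses nothing, by \<open>simple_graph_iso_nat\<close> below.\<close>

definition matching_unique :: "'a graph \<Rightarrow> bool" where
  "matching_unique G \<longleftrightarrow> \<not> (\<exists>H :: nat graph. simple_graph H \<and> comatching G H)"

lemma simple_graph_iso_nat:
  fixes G :: "'a graph"
  assumes "simple_graph G"
  shows "\<exists>H :: nat graph. simple_graph H \<and> graph_iso G H"
proof -
  have fin: "finite (verts G)" and
    edge: "\<And>e. e \<in> edges G \<Longrightarrow> e \<subseteq> verts G \<and> card e = 2"
    using assms by (auto simp: simple_graph_def)
  obtain f :: "'a \<Rightarrow> nat" where inj: "inj_on f (verts G)"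
    using finite_imp_inj_to_nat_seg[OF fin] by blast
  define H where "H = (f ` verts G, (`) f ` edges G)"
  have "card (f ` e) = 2" if "e \<in> edges G" for e
    using edge[OF that] card_image[OF inj_on_subset[OF inj]] by metis
  then have "simple_graph H"
    using fin edge by (fastforce simp: simple_graph_def H_def)
  moreover have "{u, v} \<in> edges G \<longleftrightarrow> {f u, f v} \<in> edges H"
    if "u \<in> verts G" "v \<in> verts G" for u v
  proof
    assume "{f u, f v} \<in> edges H"
    then obtain e where e: "e \<in> edges G" "f ` {u, v} = f ` e"
      by (auto simp: H_def)
    then have "{u, v} = e"
      using inj_on_image_eq_iff[OF inj, of "{u, v}" e] edge that by auto
    with e show "{u, v} \<in> edges G" by simp
  next
    assume "{u, v} \<in> edges G"
    then have "f ` {u, v} \<in> edges H"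
      unfolding H_def snd_conv by (rule imageI)
    then show "{f u, f v} \<in> edges H" by simp
  qed
  then have "graph_iso G H"
    unfolding graph_iso_def using inj by (intro exI[of _ f]) (auto simp: H_def bij_betw_def)
  ultimately show ?thesis by blast
qed

text \<open>In both graphs \<open>0\<close> is the new vertex \<open>u\<close>, the copy of \<open>K\<^sub>2\<close> has the vertices \<open>1\<close> and \<open>2\<close>,
  and \<open>3, \<dots>, t + 2\<close> are the \<open>t\<close> isolated vertices.\<close>

definition S_graph :: "nat \<Rightarrow> nat graph" where
  "S_graph t = ({0..<t + 3}, {{1, 2}, {0, 1}} \<union> {{0, i} | i. i \<in> {3..<t + 3}})"

definition S'_graph :: "nat \<Rightarrow> nat graph" where
  "S'_graph t = ({0..<t + 3}, {{1, 2}, {0, 1}, {0, 2}} \<union> {{0, i} | i. i \<in> {3..<t + 3}})"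

lemma simple_graph_S: "simple_graph (S_graph t)" "simple_graph (S'_graph t)"
  by (auto simp: simple_graph_def S_graph_def S'_graph_def)

end

theory Submission
  imports Defs
begin

text \<open>Both graphs are a star together with one further edge, and they have very few 2-matchings:
  \<open>S(t)\<close> has \<open>t + 2\<close> edges and \<open>S'(t)\<close> has \<open>t + 3\<close>, but each has only \<open>t\<close> 2-matchings, all of
  which use the further edge. The matching polynomial determines the order, the number \<open>m\<close> of edges
  and the number \<open>q\<close> of 2-matchings, and these three numbers already carry the proof of uniqueness.

  Let \<open>H\<close> be a graph with \<open>q + 2 \<le> m\<close>, let \<open>v\<close> be a vertex of maximal degree \<open>d\<close>, and let
  \<open>r = m - d\<close> be the number of edges avoiding \<open>v\<close>. Each of these \<open>r\<close> edges meets at most two edges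
  at \<open>v\<close>, so \<open>r * (d - 2) \<le> q\<close>. Each edge of \<open>H\<close> meets at most \<open>2 * (d - 1)\<close> others, so
  \<open>m * (m + 1 - 2 * d) \<le> 2 * q\<close>. If \<open>r \<ge> 2\<close>, the first inequality makes \<open>d\<close> at most 4 and the
  second then bounds \<open>m\<close>, which leaves five pairs \<open>(m, q)\<close> (lemma \<open>few_two_matchings\<close>). These are
  the pairs belonging to \<open>S(2), S(3), S(4), S'(2), S'(3)\<close>.

  In all other cases \<open>r \<le> 1\<close>. A star plus one edge \<open>{a, b}\<close> is determined up to isomorphism, once
  order, \<open>m\<close> and \<open>q\<close> are as required: \<open>q\<close> counts the leaves outside \<open>{a, b}\<close>, \<open>m\<close> tells how many
  of \<open>a, b\<close> are adjacent to the centre, and the order forbids isolated vertices (lemma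
  \<open>iso_star_plus_edge\<close>). A pure star has \<open>q = 0\<close>; it is too large for \<open>S'(0)\<close>, and for \<open>S(0)\<close> it
  is a path with two edges, which is also a star plus an edge when centred at an end vertex.

  In the five exceptional cases there is a graph with the same numbers on at most five
  vertices, padded with isolated vertices; as \<open>S(t)\<close> and \<open>S'(t)\<close> have no isolated vertex, it
  is not isomorphic to them.\<close>

section \<open>Matching numbers and the matching polynomial\<close>

lemma finite_edges:
  assumes "simple_graph G"
  shows "finite (edges G)"
proof (rule finite_subset)
  show "edges G \<subseteq> Pow (verts G)"
    using assms by (auto simp: simple_graph_def)
  show "finite (Pow (verts G))"
    using assms by (simp add: simple_graph_def)
qed

lemma card_edge: "simple_graph G \<Longrightarrow> e \<in> edges G \<Longrightarrow> card e = 2"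
  by (simp add: simple_graph_def)

lemma edge_pairE:
  assumes "simple_graph G" "e \<in> edges G"
  obtains a b where "e = {a, b}" "a \<noteq> b" "a \<in> verts G" "b \<in> verts G"
proof -
  obtain a b where "e = {a, b}" "a \<noteq> b"
    using card_edge[OF assms] by (auto simp: card_2_iff)
  moreover have "e \<subseteq> verts G"
    using assms by (auto simp: simple_graph_def)
  ultimately show thesis
    by (intro that) auto
qed

lemma not_disjnt_edge_self: "simple_graph G \<Longrightarrow> e \<in> edges G \<Longrightarrow> \<not> disjnt e e"
  by (elim edge_pairE) auto

lemma finite_k_matchings: "simple_graph G \<Longrightarrow> finite (k_matchings G k)"
  using finite_edges[of G] by (auto simp: k_matchings_def intro: finite_subset[of _ "Pow (edges G)"])

lemma num_matchings_0: "num_matchings G 0 = 1"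
proof -
  have "k_matchings G 0 = {{}}"
    by (auto simp: k_matchings_def)
  then show ?thesis
    by (simp add: num_matchings_def)
qed

lemma num_matchings_1: "num_matchings G 1 = card (edges G)"
proof -
  have "k_matchings G 1 = (\<lambda>e. {e}) ` edges G"
    by (auto simp: k_matchings_def card_1_singleton_iff)
  moreover have "inj_on (\<lambda>e. {e}) (edges G)"
    by simp
  ultimately show ?thesis
    by (simp add: num_matchings_def card_image)
qed

lemma Union_edges_subset: "simple_graph G \<Longrightarrow> \<Union>(edges G) \<subseteq> verts G"
  unfolding simple_graph_def by (intro Sup_least) blast

lemma num_matchings_eq_0:
  assumes G: "simple_graph G" and k: "card (\<Union>(edges G)) < 2 * k"
  shows "num_matchings G k = 0"
proof -
  have "k_matchings G k = {}"
  proof (rule ccontr)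
    assume "k_matchings G k \<noteq> {}"
    then obtain M where M: "M \<subseteq> edges G" "card M = k" "finite M" "pairwise disjnt M"
      by (auto simp: k_matchings_def)
    have c2: "card e = 2" if "e \<in> M" for e
      using card_edge[OF G] M that by auto
    have "card (\<Union>M) = sum card M"
      using M c2 by (intro card_Union_disjoint) (auto intro: card_ge_0_finite)
    also have "\<dots> = 2 * k"
      using M c2 by simp
    finally have "card (\<Union>M) = 2 * k" .
    moreover have "finite (\<Union>(edges G))"
      using G by (intro finite_subset[OF Union_edges_subset]) (simp_all add: simple_graph_def)
    then have "card (\<Union>M) \<le> card (\<Union>(edges G))"
      using M by (intro card_mono) auto
    ultimately show False
      using k by simp
  qed
  then show ?thesis
    by (simp add: num_matchings_def)
qed

lemma num_matchings_eq_0_order: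
  assumes G: "simple_graph G" and k: "graph_order G < 2 * k"
  shows "num_matchings G k = 0"
proof (rule num_matchings_eq_0[OF G])
  have "card (\<Union>(edges G)) \<le> card (verts G)"
    using G Union_edges_subset[OF G] by (intro card_mono) (simp_all add: simple_graph_def)
  then show "card (\<Union>(edges G)) < 2 * k"
    using k by (simp add: graph_order_def)
qed

lemma coeff_matching_poly:
  assumes "2 * k \<le> graph_order G"
  shows "coeff (matching_poly G) (graph_order G - 2 * k) = (-1) ^ k * int (num_matchings G k)"
proof -
  let ?n = "graph_order G"
  have "coeff (matching_poly G) (?n - 2 * k)
      = (\<Sum>j\<le>?n div 2. if j = k then (-1) ^ k * int (num_matchings G k) else 0)"
    unfolding matching_poly_def coeff_sum coeff_monom
    using assms by (intro sum.cong) auto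
  then show ?thesis
    using assms by simp
qed

lemma degree_matching_poly: "degree (matching_poly G) = graph_order G"
proof (rule antisym)
  show "degree (matching_poly G) \<le> graph_order G"
    unfolding matching_poly_def
    by (intro degree_sum_le) (auto intro: order_trans[OF degree_monom_le])
  have "coeff (matching_poly G) (graph_order G) \<noteq> 0"
    using coeff_matching_poly[of 0 G] by (simp add: num_matchings_0)
  then show "graph_order G \<le> degree (matching_poly G)"
    by (rule le_degree)
qed

text \<open>The order is the degree, and the signed matching numbers are the coefficients; those that
  the sum cuts off vanish because a matching covers twice as many vertices as it has edges.\<close>

lemma matching_poly_eq_iff:
  assumes G: "simple_graph G" and H: "simple_graph H"
  shows "matching_poly G = matching_poly H \<longleftrightarrow>
    graph_order G = graph_order H \<and> (\<forall>k. num_matchings G k = num_matchings H k)"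
proof
  assume eq: "matching_poly G = matching_poly H"
  then have n: "graph_order G = graph_order H"
    using degree_matching_poly by metis
  have "num_matchings G k = num_matchings H k" for k
  proof (cases "2 * k \<le> graph_order G")
    case True
    then show ?thesis
      using coeff_matching_poly[of k G] coeff_matching_poly[of k H] eq n by simp
  next
    case False
    then show ?thesis
      using num_matchings_eq_0_order[OF G] num_matchings_eq_0_order[OF H] n by simp
  qed
  with n show "graph_order G = graph_order H \<and> (\<forall>k. num_matchings G k = num_matchings H k)"
    by simp
next
  assume "graph_order G = graph_order H \<and> (\<forall>k. num_matchings G k = num_matchings H k)"
  then show "matching_poly G = matching_poly H"
    by (simp add: matching_poly_def)
qed

lemma two_matchings_eq:
  assumes "simple_graph G"
  shows "k_matchings G 2 = {{e, f} |e f. e \<in> edges G \<and> f \<in> edges G \<and> disjnt e f}"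
    (is "_ = ?R")
proof (intro set_eqI iffI)
  fix M assume "M \<in> k_matchings G 2"
  then have M: "M \<subseteq> edges G" "card M = 2" "pairwise disjnt M"
    by (simp_all add: k_matchings_def)
  obtain e f where ef: "M = {e, f}" "e \<noteq> f"
    using M(2) by (auto simp: card_2_iff)
  then have "e \<in> edges G" "f \<in> edges G" "disjnt e f"
    using M by (simp_all add: pairwise_insert)
  with ef show "M \<in> ?R"
    by blast
next
  fix M assume "M \<in> ?R"
  then obtain e f where ef: "M = {e, f}" "e \<in> edges G" "f \<in> edges G" "disjnt e f"
    by blast
  then have "e \<noteq> f"
    using not_disjnt_edge_self[OF assms] by blast
  with ef show "M \<in> k_matchings G 2"
    by (simp add: k_matchings_def pairwise_insert disjnt_sym)
qed

text \<open>Each 2-matching arises from exactly two ordered pairs of disjoint edges. This form makes it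
  possible to bound the number of 2-matchings one edge at a time, and to compute it for concrete
  graphs.\<close>

lemma card_ordered_disjoint_pairs:
  assumes G: "simple_graph G"
  shows "(\<Sum>e\<in>edges G. card {f \<in> edges G. disjnt e f}) = 2 * num_matchings G 2"
proof -
  let ?P = "SIGMA e:edges G. {f \<in> edges G. disjnt e f}"
  let ?F = "\<lambda>M. {(e, f). e \<noteq> f \<and> {e, f} = M}"
  have P: "?P = (\<Union>M\<in>k_matchings G 2. ?F M)"
  proof (intro set_eqI iffI)
    fix p assume "p \<in> ?P"
    then show "p \<in> (\<Union>M\<in>k_matchings G 2. ?F M)"
      using not_disjnt_edge_self[OF G] unfolding two_matchings_eq[OF G] by fastforce
  next
    fix p assume "p \<in> (\<Union>M\<in>k_matchings G 2. ?F M)"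
    then show "p \<in> ?P"
      by (auto simp: k_matchings_def pairwise_def)
  qed
  have fib: "finite (?F M) \<and> card (?F M) = 2" if M: "M \<in> k_matchings G 2" for M
  proof -
    obtain e f where ef: "M = {e, f}" "e \<noteq> f"
      using M by (auto simp: k_matchings_def card_2_iff)
    then have "?F M = {(e, f), (f, e)}"
      by (auto simp: doubleton_eq_iff)
    with ef show ?thesis by simp
  qed
  have "card ?P = (\<Sum>M\<in>k_matchings G 2. card (?F M))"
    unfolding P using fib finite_k_matchings[OF G]
    by (intro card_UN_disjoint) auto
  also have "\<dots> = 2 * num_matchings G 2"
    using fib by (simp add: num_matchings_def)
  finally show ?thesis
    using finite_edges[OF G] by simp
qed

section \<open>Graphs with fewer 2-matchings than edges\<close>

definition edges_at :: "'a graph \<Rightarrow> 'a \<Rightarrow> 'a set set" where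
  "edges_at G v = {e \<in> edges G. v \<in> e}"

text \<open>If all degrees are at most \<open>d\<close>, then at most \<open>2 * d - 1\<close> edges meet a given edge, which
  itself lies at both of its ends and is counted once. The inequality is the sum of this bound over
  all edges, arranged without subtraction.\<close>

lemma two_matchings_ge_degree:
  assumes G: "simple_graph G" and d: "\<And>w. card (edges_at G w) \<le> d"
  shows "card (edges G) * (card (edges G) + 1) \<le> 2 * num_matchings G 2 + 2 * d * card (edges G)"
proof -
  note fin = finite_edges[OF G]
  have *: "card (edges G) + 1 \<le> card {f \<in> edges G. disjnt e f} + 2 * d" if e: "e \<in> edges G" for e
  proof -
    obtain a b where ab: "e = {a, b}" "a \<noteq> b"
      using edge_pairE[OF G e] by metis
    have finat: "finite (edges_at G w)" for w
      using fin by (simp add: edges_at_def)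
    have "edges G = {f \<in> edges G. disjnt e f} \<union> (edges_at G a \<union> edges_at G b)"
      using ab by (auto simp: edges_at_def disjnt_def)
    then have "card (edges G) \<le> card {f \<in> edges G. disjnt e f} + card (edges_at G a \<union> edges_at G b)"
      using card_Un_le by metis
    moreover have "e \<in> edges_at G a \<inter> edges_at G b"
      using ab e by (simp add: edges_at_def)
    then have "1 \<le> card (edges_at G a \<inter> edges_at G b)"
      using finat by (metis One_nat_def Suc_leI card_gt_0_iff empty_iff finite_Int)
    then have "card (edges_at G a \<union> edges_at G b) + 1 \<le> 2 * d"
      using card_Un_Int[OF finat finat, of a b] d[of a] d[of b] by linarith
    ultimately show ?thesis by linarith
  qed
  have "card (edges G) * (card (edges G) + 1) = (\<Sum>e\<in>edges G. card (edges G) + 1)"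
    by simp
  also have "\<dots> \<le> (\<Sum>e\<in>edges G. card {f \<in> edges G. disjnt e f} + 2 * d)"
    by (intro sum_mono *)
  also have "\<dots> = 2 * num_matchings G 2 + 2 * d * card (edges G)"
    unfolding sum.distrib card_ordered_disjoint_pairs[OF G] by simp
  finally show ?thesis .
qed

text \<open>An edge \<open>{a, b}\<close> avoiding \<open>v\<close> meets only the edges \<open>{v, a}\<close> and \<open>{v, b}\<close> at \<open>v\<close>, and forms
  a 2-matching with each of the others.\<close>

lemma two_matchings_ge_vertex:
  fixes G :: "'a graph" and v :: 'a
  assumes G: "simple_graph G"
  defines "r \<equiv> card (edges G - edges_at G v)"
  shows "r * card (edges_at G v) \<le> num_matchings G 2 + 2 * r"
proof -
  let ?R = "edges G - edges_at G v"
  let ?Q = "SIGMA f:?R. {e \<in> edges_at G v. disjnt f e}"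
  have fin: "finite (edges_at G v)" "finite ?R"
    using finite_edges[OF G] by (auto simp: edges_at_def)
  have *: "card (edges_at G v) \<le> card {e \<in> edges_at G v. disjnt f e} + 2" if f: "f \<in> ?R" for f
  proof -
    obtain a b where ab: "f = {a, b}" "a \<noteq> b"
      using edge_pairE[OF G] f by blast
    have "e = {v, a} \<or> e = {v, b}" if e: "e \<in> edges_at G v" "\<not> disjnt f e" for e
    proof -
      obtain c d where "e = {c, d}"
        using edge_pairE[OF G, of e] e unfolding edges_at_def by blast
      then show ?thesis
        using e ab f by (auto simp: edges_at_def)
    qed
    then have "edges_at G v \<subseteq> {e \<in> edges_at G v. disjnt f e} \<union> {{v, a}, {v, b}}"
      by auto
    then have "card (edges_at G v) \<le> card ({e \<in> edges_at G v. disjnt f e} \<union> {{v, a}, {v, b}})"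
      using fin by (intro card_mono) auto
    also have "\<dots> \<le> card {e \<in> edges_at G v. disjnt f e} + card {{v, a}, {v, b}}"
      by (rule card_Un_le)
    also have "\<dots> \<le> card {e \<in> edges_at G v. disjnt f e} + 2"
      by (simp add: card_insert_if)
    finally show ?thesis .
  qed
  have "inj_on (\<lambda>(f, e). {f, e}) ?Q"
    by (auto simp: inj_on_def doubleton_eq_iff edges_at_def)
  moreover have "(\<lambda>(f, e). {f, e}) ` ?Q \<subseteq> k_matchings G 2"
    unfolding two_matchings_eq[OF G] by (auto simp: edges_at_def)
  ultimately have "card ?Q \<le> num_matchings G 2"
    unfolding num_matchings_def using finite_k_matchings[OF G] by (rule card_inj_on_le)
  then have Q: "(\<Sum>f\<in>?R. card {e \<in> edges_at G v. disjnt f e}) \<le> num_matchings G 2"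
    using fin by simp
  have "r * card (edges_at G v) = (\<Sum>f\<in>?R. card (edges_at G v))"
    by (simp add: r_def)
  also have "\<dots> \<le> (\<Sum>f\<in>?R. card {e \<in> edges_at G v. disjnt f e} + 2)"
    by (intro sum_mono *)
  also have "\<dots> \<le> num_matchings G 2 + 2 * r"
    unfolding sum.distrib using Q by (simp add: r_def)
  finally show ?thesis .
qed

text \<open>The arithmetic of the two bounds, with \<open>d\<close> for the maximal degree, \<open>r\<close> for the number of
  edges avoiding a vertex of that degree, and \<open>q\<close> for the number of 2-matchings. From \<open>A\<close> and \<open>q\<close>
  follows \<open>(r - 1) * (d - 2) \<le> r\<close>, hence \<open>d \<le> 4\<close>; for such \<open>d\<close>, the quadratic growth in \<open>B\<close>
  or the linear growth in \<open>A\<close> bounds \<open>r\<close>, and finitely many cases remain.\<close>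

lemma sparse_counts:
  fixes d r q :: nat
  assumes A: "r * d \<le> q + 2 * r" and B: "(d + r) * (d + r + 1) \<le> 2 * q + 2 * d * (d + r)"
    and q: "q + 2 \<le> d + r" and r: "2 \<le> r"
  shows "(d + r, q) \<in> {(4, 2), (5, 2), (5, 3), (6, 3), (6, 4)}"
proof -
  have "d \<le> 4"
  proof (rule ccontr)
    assume "\<not> d \<le> 4"
    then obtain c where c: "d = 5 + c"
      using le_Suc_ex[of 5 d] by auto
    obtain s where s: "r = 2 + s"
      using r le_Suc_ex by blast
    show False
      using A q unfolding c s by (simp add: algebra_simps)
  qed
  moreover have "r \<le> 4"
  proof (rule ccontr)
    assume "\<not> r \<le> 4"
    then obtain s where s: "r = 5 + s"
      using le_Suc_ex[of 5 r] by auto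
    have "d = 0 \<or> d = 1 \<or> d = 2 \<or> d = 3 \<or> d = 4"
      using \<open>d \<le> 4\<close> by auto
    then show False
      using A B q unfolding s by (elim disjE; simp add: algebra_simps)
  qed
  ultimately have "d \<in> {0, 1, 2, 3, 4}" "r \<in> {2, 3, 4}"
    using r by auto
  then show ?thesis
    using A B q unfolding insert_iff empty_iff prod.inject by (elim disjE; simp; presburger)
qed

text \<open>The centre \<open>v\<close> is a vertex of maximal degree, so that both lower bounds on the number of
  2-matchings apply with the same degree. The five exceptional pairs do occur, for instance for
  the 4-cycle and for \<open>K\<^sub>4\<close>.\<close>

lemma few_two_matchings:
  assumes G: "simple_graph G" and few: "num_matchings G 2 + 2 \<le> card (edges G)"
    and exc: "(card (edges G), num_matchings G 2) \<notin> {(4, 2), (5, 2), (5, 3), (6, 3), (6, 4)}"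
  shows "\<exists>v. card (edges G - edges_at G v) \<le> 1"
proof -
  have at: "edges_at G w \<subseteq> edges G" for w
    by (auto simp: edges_at_def)
  note fin = finite_edges[OF G]
  have "card (edges_at G w) < Suc (card (edges G))" for w
    using card_mono[OF fin at] by (simp add: le_imp_less_Suc)
  then obtain v where v: "\<And>w. card (edges_at G w) \<le> card (edges_at G v)"
    using ex_has_greatest_nat[of "\<lambda>_. True" undefined "\<lambda>w. card (edges_at G w)" "Suc (card (edges G))"]
    by auto
  let ?d = "card (edges_at G v)" and ?r = "card (edges G - edges_at G v)"
  have m: "card (edges G) = ?d + ?r"
    using card_Diff_subset[OF finite_subset[OF at fin] at] card_mono[OF fin at] by simp
  have "?r \<le> 1"
  proof (rule ccontr)
    assume "\<not> ?r \<le> 1"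
    then have "(?d + ?r, num_matchings G 2) \<in> {(4, 2), (5, 2), (5, 3), (6, 3), (6, 4)}"
      using two_matchings_ge_vertex[OF G, of v] two_matchings_ge_degree[OF G v] few
      by (intro sparse_counts) (simp_all add: m)
    then show False
      using exc m by simp
  qed
  then show ?thesis ..
qed

section \<open>Stars with one further edge\<close>

definition neighbours :: "'a graph \<Rightarrow> 'a \<Rightarrow> 'a set" where
  "neighbours G v = {x. {v, x} \<in> edges G}"

lemma edges_at_eq:
  assumes G: "simple_graph G"
  shows "edges_at G v = (\<lambda>x. {v, x}) ` neighbours G v"
proof (intro set_eqI iffI)
  fix e assume e: "e \<in> edges_at G v"
  then have "e \<in> edges G"
    by (simp add: edges_at_def)
  then obtain c d where "e = {c, d}"
    using edge_pairE[OF G] by metis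
  then obtain x where x: "e = {v, x}"
    using e unfolding edges_at_def by (metis (lifting) insertE insert_commute mem_Collect_eq singletonD)
  then have "x \<in> neighbours G v"
    using \<open>e \<in> edges G\<close> by (simp add: neighbours_def)
  then show "e \<in> (\<lambda>x. {v, x}) ` neighbours G v"
    unfolding x by (rule imageI)
next
  fix e assume "e \<in> (\<lambda>x. {v, x}) ` neighbours G v"
  then show "e \<in> edges_at G v"
    by (elim imageE) (simp add: edges_at_def neighbours_def)
qed

lemma neighbours_subset:
  assumes G: "simple_graph G"
  shows "neighbours G v \<subseteq> verts G - {v}"
proof
  fix x assume "x \<in> neighbours G v"
  then have "{v, x} \<subseteq> verts G" "card {v, x} = 2"
    using G unfolding neighbours_def simple_graph_def by blast+
  then show "x \<in> verts G - {v}"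
    by (cases "x = v") auto
qed

lemma inj_on_star: "inj_on (\<lambda>x. {v, x}) A"
  by (auto simp: inj_on_def doubleton_eq_iff)

text \<open>Any two edges at \<open>v\<close> meet, so a matching contains at most one of them besides \<open>{a, b}\<close>.\<close>

lemma star_plus_edge_counts:
  assumes G: "simple_graph G" and E: "edges G = insert {a, b} ((\<lambda>x. {v, x}) ` N)"
    and ne: "a \<noteq> v" "b \<noteq> v" "v \<notin> N"
  shows "card (edges G) = card N + 1"
    and "num_matchings G 2 = card (N - {a, b})"
    and "3 \<le> k \<Longrightarrow> num_matchings G k = 0"
proof -
  have "finite ((\<lambda>x. {v, x}) ` N)"
    using finite_edges[OF G] by (simp add: E)
  moreover have "{a, b} \<notin> (\<lambda>x. {v, x}) ` N"
    using ne by auto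
  ultimately show "card (edges G) = card N + 1"
    unfolding E by (simp add: card_image[OF inj_on_star])
  have "k_matchings G 2 = (\<lambda>x. {{a, b}, {v, x}}) ` (N - {a, b})"
  proof (intro set_eqI iffI)
    fix M assume "M \<in> k_matchings G 2"
    then obtain e f where ef: "M = {e, f}" "e \<in> edges G" "f \<in> edges G" "disjnt e f"
      unfolding two_matchings_eq[OF G] by blast
    then have "\<not> (v \<in> e \<and> v \<in> f)"
      by (auto simp: disjnt_def)
    then have "e = {a, b} \<or> f = {a, b}"
      using ef(2,3) unfolding E by blast
    then obtain g where g: "M = {{a, b}, g}" "g \<in> edges G" "disjnt {a, b} g"
    proof
      assume "e = {a, b}"
      with ef show thesis
        by (intro that[of f]) simp_all
    next
      assume "f = {a, b}"
      with ef show thesis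
        by (intro that[of e]) (simp_all add: disjnt_def Int_commute insert_commute[of e "{a, b}"])
    qed
    then have "g \<noteq> {a, b}"
      by auto
    then obtain x where "x \<in> N" "g = {v, x}"
      using g(2) unfolding E by blast
    with g show "M \<in> (\<lambda>x. {{a, b}, {v, x}}) ` (N - {a, b})"
      by auto
  next
    fix M assume "M \<in> (\<lambda>x. {{a, b}, {v, x}}) ` (N - {a, b})"
    then obtain x where x: "x \<in> N" "x \<notin> {a, b}" "M = {{a, b}, {v, x}}"
      by blast
    have "{a, b} \<in> edges G" "{v, x} \<in> edges G" "disjnt {a, b} {v, x}"
      using x ne by (simp_all add: E)
    then show "M \<in> k_matchings G 2"
      unfolding two_matchings_eq[OF G] x(3) by blast
  qed
  moreover have "inj_on (\<lambda>x. {{a, b}, {v, x}}) (N - {a, b})"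
    by (auto simp: inj_on_def doubleton_eq_iff)
  ultimately show "num_matchings G 2 = card (N - {a, b})"
    by (simp add: num_matchings_def card_image)
  assume k: "3 \<le> k"
  have "k_matchings G k = {}"
  proof (rule ccontr)
    assume "k_matchings G k \<noteq> {}"
    then obtain M where M: "M \<subseteq> edges G" "card M = k" "finite M" "pairwise disjnt M"
      by (auto simp: k_matchings_def)
    have "2 \<le> card (M - {{a, b}})"
      using M k by (auto simp: card_Diff_singleton_if)
    then obtain T where T: "T \<subseteq> M - {{a, b}}" "card T = 2"
      by (rule obtain_subset_with_card_n)
    then obtain e f where ef: "T = {e, f}" "e \<noteq> f"
      by (auto simp: card_2_iff)
    then have "disjnt e f"
      using T M(4) by (auto simp: pairwise_def)
    moreover have "v \<in> e" "v \<in> f"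
      using T(1) M(1) unfolding ef E by blast+
    ultimately show False
      by (auto simp: disjnt_def)
  qed
  then show "num_matchings G k = 0"
    by (simp add: num_matchings_def)
qed

lemma graph_isoI:
  assumes G: "simple_graph G" and bij: "bij_betw g (verts G) (verts H)"
    and E: "edges H = (`) g ` edges G"
  shows "graph_iso G H"
  unfolding graph_iso_def
proof (intro exI conjI ballI)
  show "bij_betw g (verts G) (verts H)" by fact
  fix u v assume uv: "u \<in> verts G" "v \<in> verts G"
  have "inj_on ((`) g) (Pow (verts G))"
    using bij by (intro inj_on_image_Pow) (simp add: bij_betw_def)
  moreover have "edges G \<subseteq> Pow (verts G)"
    using G by (auto simp: simple_graph_def)
  ultimately have "g ` {u, v} \<in> (`) g ` edges G \<longleftrightarrow> {u, v} \<in> edges G"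
    using uv by (intro inj_on_image_mem_iff) auto
  then show "{u, v} \<in> edges G \<longleftrightarrow> {g u, g v} \<in> edges H"
    by (simp add: E)
qed

text \<open>The centre \<open>v\<close> and the ends of the further edge correspond to the vertices 0, 1, 2, and the
  neighbours of \<open>v\<close> off that edge, of which there are \<open>t\<close> because they count the 2-matchings, to
  \<open>3, \<dots>, t + 2\<close>. The number of edges decides whether one or both ends are adjacent to \<open>v\<close>.\<close>

lemma iso_star_plus_edge:
  assumes G: "simple_graph G" and t: "num_matchings G 2 = t" and n: "graph_order G = t + 3"
    and v: "card (edges G - edges_at G v) = 1"
  shows "card (edges G) = t + 2 \<Longrightarrow> graph_iso (S_graph t) G"
    and "card (edges G) = t + 3 \<Longrightarrow> graph_iso (S'_graph t) G"
proof -
  let ?N = "neighbours G v"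
  obtain e where e: "edges G - edges_at G v = {e}"
    using v by (auto simp: card_1_singleton_iff)
  then have eG: "e \<in> edges G" "v \<notin> e"
    by (auto simp: edges_at_def)
  obtain c d where cd: "e = {c, d}" "c \<noteq> d" "c \<in> verts G" "d \<in> verts G"
    using eG(1) by (rule edge_pairE[OF G])
  obtain a b where ab: "e = {a, b}" "a \<noteq> b" "a \<in> verts G" "b \<in> verts G"
      and ba: "b \<in> ?N \<longrightarrow> a \<in> ?N"
    \<comment> \<open>If only one end is adjacent to the centre, it must be \<open>a\<close>, the image of the vertex 1.\<close>
  proof (cases "d \<in> ?N")
    case True
    with cd show thesis
      by (intro that[of d c]) auto
  next
    case False
    with cd show thesis
      by (intro that[of c d]) auto
  qed
  have ne: "a \<noteq> v" "b \<noteq> v" "v \<notin> ?N"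
    using eG ab neighbours_subset[OF G] by auto
  have "edges G = insert e (edges_at G v)"
    using e by (auto simp: edges_at_def)
  then have E: "edges G = insert {a, b} ((\<lambda>x. {v, x}) ` ?N)"
    by (simp add: edges_at_eq[OF G] ab)
  note cnt = star_plus_edge_counts[OF G E ne]
  let ?L = "?N - {a, b}"
  have L: "card ?L = t"
    using cnt(2) t by simp
  have finV: "finite (verts G)"
    using G by (simp add: simple_graph_def)
  have finN: "finite ?N"
    using finite_subset[OF neighbours_subset[OF G]] finV by blast
  have vV: "v \<in> verts G" if "?N \<noteq> {}"
    using that G by (auto simp: neighbours_def simple_graph_def)
  have cN: "card ?N = card ?L + card (?N \<inter> {a, b})"
    using card_Int_Diff[of ?N "{a, b}"] finN by simp
  obtain g where g: "bij_betw g {3..<t + 3} ?L"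
    using finN L finite_same_card_bij[of "{3..<t + 3}" ?L] by auto
  define h where "h = g(0 := v, 1 := a, 2 := b)"
  have h012: "h 0 = v" "h 1 = a" "h 2 = b" and hg: "\<And>i. i \<in> {3..<t + 3} \<Longrightarrow> h i = g i"
    by (auto simp: h_def)
  have split: "{0..<t + 3} = {0, 1, 2} \<union> {3..<t + 3}"
    by auto
  have hL: "bij_betw h {3..<t + 3} ?L"
    using g bij_betw_cong[of "{3..<t + 3}" h g ?L, OF hg] by blast
  moreover have "inj_on h {0, 1, 2}" "h ` {0, 1, 2} = {v, a, b}"
    using ne ab(2) h012 by simp_all
  then have "bij_betw h {0, 1, 2} {v, a, b}"
    by (rule bij_betw_imageI)
  moreover have "{v, a, b} \<inter> ?L = {}"
    using ne by blast
  ultimately have "bij_betw h {0..<t + 3} ({v, a, b} \<union> ?L)"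
    unfolding split by (intro bij_betw_combine)
  then have inj: "inj_on h {0..<t + 3}" and img: "h ` {0..<t + 3} = {v, a, b} \<union> ?L"
    by (auto simp: bij_betw_def)
  have bij: "bij_betw h {0..<t + 3} (verts G)" if "?N \<noteq> {}"
  proof -
    have "h ` {0..<t + 3} \<subseteq> verts G"
      unfolding img using ab vV[OF that] neighbours_subset[OF G, of v] by blast
    moreover have "card (h ` {0..<t + 3}) = card (verts G)"
      using n card_image[OF inj] by (simp add: graph_order_def)
    ultimately show ?thesis
      using inj finV by (intro bij_betw_imageI card_subset_eq)
  qed
  have star: "(`) h ` {{0, i} |i. i \<in> {3..<t + 3}} = (\<lambda>x. {v, x}) ` ?L"
  proof -
    have "(`) h ` {{0, i} |i. i \<in> {3..<t + 3}} = (\<lambda>x. {v, x}) ` h ` {3..<t + 3}"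
      by (simp only: setcompr_eq_image Collect_mem_eq image_image image_insert image_empty h012)
    then show ?thesis
      using hL by (simp add: bij_betw_def)
  qed
  show "graph_iso (S_graph t) G" if m: "card (edges G) = t + 2"
  proof (rule graph_isoI[OF simple_graph_S(1), where g = h])
    have one: "card (?N \<inter> {a, b}) = 1"
      using cnt(1) m cN L by linarith
    have a: "a \<in> ?N"
    proof (rule ccontr)
      assume "a \<notin> ?N"
      with ba have "?N \<inter> {a, b} = {}"
        by simp
      with one show False
        by simp
    qed
    have "b \<notin> ?N"
    proof
      assume "b \<in> ?N"
      with a have "?N \<inter> {a, b} = {a, b}"
        by simp
      with one ab(2) show False
        by simp
    qed
    with a have N: "?N = insert a ?L"
      by blast
    have "?N \<noteq> {}"
      using a by blast
    from bij[OF this] show "bij_betw h (verts (S_graph t)) (verts G)"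
      by (simp add: S_graph_def)
    show "edges G = (`) h ` edges (S_graph t)"
      unfolding S_graph_def snd_conv image_Un star
      by (subst E, subst N) (simp add: h012 del: One_nat_def)
  qed
  show "graph_iso (S'_graph t) G" if m: "card (edges G) = t + 3"
  proof (rule graph_isoI[OF simple_graph_S(2), where g = h])
    have two: "card (?N \<inter> {a, b}) = 2"
      using cnt(1) m cN L by linarith
    have "?N \<inter> {a, b} = {a, b}"
      using ab(2) two by (intro card_subset_eq) simp_all
    then have aN: "a \<in> ?N" "b \<in> ?N"
      by blast+
    then have N: "?N = insert a (insert b ?L)"
      by blast
    have "?N \<noteq> {}"
      using aN by blast
    from bij[OF this] show "bij_betw h (verts (S'_graph t)) (verts G)"
      by (simp add: S'_graph_def)
    show "edges G = (`) h ` edges (S'_graph t)"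
      unfolding S'_graph_def snd_conv image_Un star
      by (subst E, subst N) (simp add: h012 del: One_nat_def)
  qed
qed

section \<open>The graphs determined by their matching polynomial\<close>

lemma S_graph_counts:
  "graph_order (S_graph t) = t + 3"
  "num_matchings (S_graph t) 1 = t + 2"
  "num_matchings (S_graph t) 2 = t"
  "3 \<le> k \<Longrightarrow> num_matchings (S_graph t) k = 0"
proof -
  let ?N = "insert 1 {3..<t + 3}"
  have E: "edges (S_graph t) = insert {1, 2} ((\<lambda>x. {0, x}) ` ?N)"
    by (auto simp: S_graph_def)
  have L: "?N - {1, 2} = {3..<t + 3}"
    by auto
  note c = star_plus_edge_counts[OF simple_graph_S(1) E]
  show "graph_order (S_graph t) = t + 3"
    by (simp add: graph_order_def S_graph_def)
  show "num_matchings (S_graph t) 1 = t + 2"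
    unfolding num_matchings_1 using c(1) by simp
  show "num_matchings (S_graph t) 2 = t"
    using c(2) L by simp
  show "3 \<le> k \<Longrightarrow> num_matchings (S_graph t) k = 0"
    using c(3) by simp
qed

lemma S'_graph_counts:
  "graph_order (S'_graph t) = t + 3"
  "num_matchings (S'_graph t) 1 = t + 3"
  "num_matchings (S'_graph t) 2 = t"
  "3 \<le> k \<Longrightarrow> num_matchings (S'_graph t) k = 0"
proof -
  let ?N = "{1, 2} \<union> {3..<t + 3}"
  have E: "edges (S'_graph t) = insert {1, 2} ((\<lambda>x. {0, x}) ` ?N)"
    by (auto simp: S'_graph_def)
  have L: "?N - {1, 2} = {3..<t + 3}"
    by auto
  note c = star_plus_edge_counts[OF simple_graph_S(2) E]
  show "graph_order (S'_graph t) = t + 3"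
    by (simp add: graph_order_def S'_graph_def)
  show "num_matchings (S'_graph t) 1 = t + 3"
    unfolding num_matchings_1 using c(1) by simp
  show "num_matchings (S'_graph t) 2 = t"
    using c(2) L by simp
  show "3 \<le> k \<Longrightarrow> num_matchings (S'_graph t) k = 0"
    using c(3) by simp
qed

lemma S_graph_unique:
  assumes t: "t \<notin> {2, 3, 4}"
  shows "matching_unique (S_graph t)"
  unfolding matching_unique_def
proof clarify
  fix H :: "nat graph"
  assume H: "simple_graph H" and co: "comatching (S_graph t) H"
  then have "graph_order H = t + 3 \<and> (\<forall>k. num_matchings (S_graph t) k = num_matchings H k)"
    using matching_poly_eq_iff[OF simple_graph_S(1) H] by (auto simp: comatching_def S_graph_counts(1))
  then have n: "graph_order H = t + 3" and m: "card (edges H) = t + 2"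
    and q: "num_matchings H 2 = t"
    using S_graph_counts[of t] num_matchings_1[of H] by metis+
  obtain v where v: "card (edges H - edges_at H v) \<le> 1"
    using few_two_matchings[OF H] m q t by force
  have "\<exists>v. card (edges H - edges_at H v) = 1"
  proof (cases "card (edges H - edges_at H v) = 1")
    case False
    then have "edges H - edges_at H v = {}"
      using v finite_edges[OF H] by (simp add: le_Suc_eq)
    then have at: "edges H = edges_at H v"
      by (auto simp: edges_at_def)
    then have "k_matchings H 2 = {}"
      unfolding two_matchings_eq[OF H] by (auto simp: edges_at_def disjnt_def)
    then have "t = 0"
      using q by (simp add: num_matchings_def)
    \<comment> \<open>Two edges with a common vertex form a path; its end vertex \<open>a\<close> lies on one edge only.\<close>
    then obtain e f where ef: "edges H = {e, f}" "e \<noteq> f"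
      using m card_2_iff[of "edges H"] by auto
    then have "card e = 2" "card f = 2"
      using card_edge[OF H] by auto
    then obtain a where "a \<in> e" "a \<notin> f"
      using ef by (metis card_subset_eq card_ge_0_finite subsetI zero_less_numeral)
    then have "edges H - edges_at H a = {f}"
      using ef by (auto simp: edges_at_def)
    then show ?thesis
      by (intro exI[of _ a]) simp
  qed auto
  then have "graph_iso (S_graph t) H"
    using iso_star_plus_edge(1)[OF H q n] m by blast
  then show False
    using co by (simp add: comatching_def)
qed

lemma S'_graph_unique:
  assumes t: "t \<notin> {2, 3}"
  shows "matching_unique (S'_graph t)"
  unfolding matching_unique_def
proof clarify
  fix H :: "nat graph"
  assume H: "simple_graph H" and co: "comatching (S'_graph t) H"
  then have "graph_order H = t + 3 \<and> (\<forall>k. num_matchings (S'_graph t) k = num_matchings H k)"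
    using matching_poly_eq_iff[OF simple_graph_S(2) H] by (auto simp: comatching_def S'_graph_counts(1))
  then have n: "graph_order H = t + 3" and m: "card (edges H) = t + 3"
    and q: "num_matchings H 2 = t"
    using S'_graph_counts[of t] num_matchings_1[of H] by metis+
  obtain v where v: "card (edges H - edges_at H v) \<le> 1"
    using few_two_matchings[OF H] m q t by force
  have "card (edges H - edges_at H v) = 1"
  proof (rule ccontr)
    assume "card (edges H - edges_at H v) \<noteq> 1"
    then have "edges H - edges_at H v = {}"
      using v finite_edges[OF H] by (simp add: le_Suc_eq)
    then have "edges H = edges_at H v"
      by (auto simp: edges_at_def)
    \<comment> \<open>A star with \<open>t + 3\<close> edges has \<open>t + 4\<close> vertices, one more than \<open>H\<close>.\<close>
    then have "card (neighbours H v) = t + 3"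
      using m edges_at_eq[OF H, of v] by (simp add: card_image[OF inj_on_star])
    moreover from this obtain x where "{v, x} \<in> edges H"
      by (fastforce simp: neighbours_def)
    then have "v \<in> verts H" "finite (verts H)"
      using H by (auto simp: simple_graph_def)
    then have "card (neighbours H v) < card (verts H)"
      using neighbours_subset[OF H, of v] by (intro psubset_card_mono) auto
    ultimately show False
      using n by (simp add: graph_order_def)
  qed
  then have "graph_iso (S'_graph t) H"
    using iso_star_plus_edge(2)[OF H q n] m by blast
  then show False
    using co by (simp add: comatching_def)
qed

section \<open>The exceptional graphs\<close>

text \<open>An isolated vertex of \<open>H\<close> rules out an isomorphism. As the edges of \<open>H\<close> cover at most five
  vertices, \<open>H\<close> has no 3-matching, so that only edges and 2-matchings have to be counted; the
  latter count is a double sum that the simplifier evaluates for an explicit edge set.\<close>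

lemma not_matching_unique:
  fixes H :: "nat graph"
  assumes G: "simple_graph G" and spanning: "\<Union>(edges G) = verts G"
    and H: "simple_graph H" and isolated: "w \<in> verts H" "w \<notin> \<Union>(edges H)"
    and order: "card (verts H) = graph_order G"
    and small: "card (\<Union>(edges H)) \<le> 5" and G3: "\<And>k. 3 \<le> k \<Longrightarrow> num_matchings G k = 0"
    and m: "card (edges H) = num_matchings G 1"
    and q: "(\<Sum>e\<in>edges H. \<Sum>f\<in>edges H. if disjnt e f then 1 else 0) = 2 * num_matchings G 2"
  shows "\<not> matching_unique G"
proof -
  have "\<not> graph_iso G H"
  proof
    assume "graph_iso G H"
    then obtain g where bij: "bij_betw g (verts G) (verts H)"
      and hom: "\<And>u v. u \<in> verts G \<Longrightarrow> v \<in> verts G \<Longrightarrow> {u, v} \<in> edges G \<Longrightarrow> {g u, g v} \<in> edges H"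
      by (auto simp: graph_iso_def)
    obtain u where u: "u \<in> verts G" "w = g u"
      using bij isolated(1) unfolding bij_betw_def by blast
    then obtain e where e: "e \<in> edges G" "u \<in> e"
      using spanning by auto
    obtain a b where ab: "e = {a, b}" "a \<in> verts G" "b \<in> verts G"
      using edge_pairE[OF G e(1)] by metis
    have "{g a, g b} \<in> edges H"
      using hom ab e(1) by simp
    moreover have "w \<in> {g a, g b}"
      using e(2) u(2) ab(1) by auto
    ultimately show False
      using isolated(2) by blast
  qed
  moreover have "num_matchings G k = num_matchings H k" for k
  proof -
    have fin: "finite (edges H)"
      by (rule finite_edges[OF H])
    have "card {f \<in> edges H. disjnt e f} = (\<Sum>f\<in>edges H. if disjnt e f then 1 else 0)" for e
      by (simp add: sum.inter_filter[OF fin, symmetric])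
    then have 2: "num_matchings H 2 = num_matchings G 2"
      using card_ordered_disjoint_pairs[OF H] q by simp
    have 3: "num_matchings H k = 0" if "3 \<le> k"
      using small that by (intro num_matchings_eq_0[OF H]) simp
    consider "k = 0" | "k = 1" | "k = 2" | "3 \<le> k"
      by linarith
    then show ?thesis
      by cases (simp_all only: 2 3 G3 m[unfolded num_matchings_1] num_matchings_0 num_matchings_1)
  qed
  ultimately have "comatching G H"
    using matching_poly_eq_iff[OF G H] order by (auto simp: comatching_def graph_order_def)
  with H show ?thesis
    unfolding matching_unique_def by blast
qed

lemma Union_edges_S: "\<Union>(edges (S_graph t)) = verts (S_graph t)"
  "\<Union>(edges (S'_graph t)) = verts (S'_graph t)"
proof -
  have split: "{0..<t + 3} = {0, 1, 2} \<union> {3..<t + 3}"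
    by auto
  show "\<Union>(edges (S_graph t)) = verts (S_graph t)"
    "\<Union>(edges (S'_graph t)) = verts (S'_graph t)"
    unfolding S_graph_def S'_graph_def fst_conv snd_conv split by blast+
qed

text \<open>Isolated vertices are added to a 4-cycle, to a triangle with pendant edges at two of its
  vertices, and to \<open>K\<^sub>4\<close> minus an edge with a pendant edge at a vertex of degree 3.\<close>

lemma S_graph_not_unique:
  assumes "t \<in> {2, 3, 4}"
  shows "\<not> matching_unique (S_graph t)"
proof -
  note * = not_matching_unique[OF simple_graph_S(1) Union_edges_S(1)]
  have "\<not> matching_unique (S_graph 2)"
    by (rule *[where H = "({0..<5}, {{0, 1}, {1, 2}, {2, 3}, {3, 0}})" and w = 4])
      (simp_all add: S_graph_counts simple_graph_def doubleton_eq_iff disjnt_def card_insert_if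
        del: One_nat_def)
  moreover have "\<not> matching_unique (S_graph 3)"
    by (rule *[where H = "({0..<6}, {{0, 1}, {1, 2}, {2, 0}, {0, 3}, {1, 4}})" and w = 5])
      (simp_all add: S_graph_counts simple_graph_def doubleton_eq_iff disjnt_def card_insert_if
        del: One_nat_def)
  moreover have "\<not> matching_unique (S_graph 4)"
    by (rule *[where H = "({0..<7}, {{0, 1}, {0, 2}, {0, 3}, {1, 2}, {1, 3}, {0, 4}})" and w = 6])
      (simp_all add: S_graph_counts simple_graph_def doubleton_eq_iff disjnt_def card_insert_if
        del: One_nat_def)
  ultimately show ?thesis
    using assms by auto
qed

text \<open>Isolated vertices are added to \<open>K\<^sub>4\<close> minus an edge and to \<open>K\<^sub>4\<close>.\<close>

lemma S'_graph_not_unique: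
  assumes "t \<in> {2, 3}"
  shows "\<not> matching_unique (S'_graph t)"
proof -
  note * = not_matching_unique[OF simple_graph_S(2) Union_edges_S(2)]
  have "\<not> matching_unique (S'_graph 2)"
    by (rule *[where H = "({0..<5}, {{0, 1}, {0, 2}, {0, 3}, {1, 2}, {1, 3}})" and w = 4])
      (simp_all add: S'_graph_counts simple_graph_def doubleton_eq_iff disjnt_def card_insert_if
        del: One_nat_def)
  moreover have "\<not> matching_unique (S'_graph 3)"
    by (rule *[where H = "({0..<6}, {{0, 1}, {0, 2}, {0, 3}, {1, 2}, {1, 3}, {2, 3}})" and w = 5])
      (simp_all add: S'_graph_counts simple_graph_def doubleton_eq_iff disjnt_def card_insert_if
        del: One_nat_def)
  ultimately show ?thesis
    using assms by auto
qed

theorem theorem11: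
  fixes t :: nat
  shows "(matching_unique (S_graph t) \<longleftrightarrow> t \<notin> {2, 3, 4}) \<and>
         (matching_unique (S'_graph t) \<longleftrightarrow> t \<notin> {2, 3})"
  using S_graph_unique[of t] S_graph_not_unique[of t] S'_graph_unique[of t] S'_graph_not_unique[of t]
  by satx

end
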